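(* For $n \ge 2$, every $n$-vertex connected graph with $m$ edges and maximum degree $\Delta$ has a bisection of size at least $\frac{m}{2} + \frac{n + 1 - \Delta}{4}$.
   Context: Graphs are finite and simple. A bisection of a graph is a bipartition $V = V_1 \cup V_2$ of its vertex set into disjoint parts with $\big||V_1|-|V_2|\big| \le 1$; its size is the number $e(V_1,V_2)$ of edges with one endpoint in each part. *)

theory Defs
  imports Complex_Main
begin

text \<open>A finite simple graph is given by its vertex set \<open>V\<close> and its set \<open>E\<close> of undirected edges,
  each of which is a two-element subset of \<open>V\<close>.\<close>

locale simple_graph =
  fixes V :: "'a set" and E :: "'a set set"
  assumes finite_verts: "finite V"
    and edge_subset: "e \<in> E \<Longrightarrow> e \<subseteq> V"
    and edge_card: "e \<in> E \<Longrightarrow> card e = 2"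

text \<open>Walks are taken along edges of \<open>E\<close>; in a simple graph they cannot leave \<open>V\<close>.\<close>

definition connected_graph :: "'a set \<Rightarrow> 'a set set \<Rightarrow> bool" where
  "connected_graph V E \<longleftrightarrow> V \<noteq> {} \<and> (\<forall>u\<in>V. \<forall>v\<in>V. (u, v) \<in> {(x, y). {x, y} \<in> E}\<^sup>*)"

definition degree :: "'a set set \<Rightarrow> 'a \<Rightarrow> nat" where
  "degree E v = card {e \<in> E. v \<in> e}"

text \<open>Only meaningful for finite nonempty \<open>V\<close>.\<close>

definition max_degree :: "'a set \<Rightarrow> 'a set set \<Rightarrow> nat" where
  "max_degree V E = Max (degree E ` V)"

text \<open>The cardinalities are compared as integers, since subtraction on \<open>nat\<close> truncates.\<close>

definition bisection :: "'a set \<Rightarrow> 'a set \<Rightarrow> 'a set \<Rightarrow> bool" where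
  "bisection V V1 V2 \<longleftrightarrow>
     V1 \<union> V2 = V \<and> V1 \<inter> V2 = {} \<and> \<bar>int (card V1) - int (card V2)\<bar> \<le> 1"

definition edges_between :: "'a set set \<Rightarrow> 'a set \<Rightarrow> 'a set \<Rightarrow> nat" where
  "edges_between E V1 V2 = card {e \<in> E. \<exists>x\<in>V1. \<exists>y\<in>V2. e = {x, y}}"

end

theory Submission
  imports Defs
begin

text \<open>Split the edges of a maximum matching at random: its edges are always cut and the other edges
  between matched vertices are cut with probability one half. The unmatched vertices form an
  independent set. Group them by how they see the matching, that is, by the function taking a
  matched \<open>x\<close> with partner \<open>x'\<close> to \<open>[w \<sim> x] - [w \<sim> x']\<close>. Pair up unmatched vertices from different
  groups as long as possible; orienting such a pair in the better way gains at least one half in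
  expectation. The remaining vertices all lie in one group. If its function is nonzero, then they
  have a common matched neighbour, so there are at most \<open>\<Delta> - 1\<close> of them. If it is zero, connectivity
  shows, for a suitable maximum matching, that only one vertex is unmatched at all.\<close>

section \<open>Pairings as involutions\<close>

text \<open>A pairing is encoded as an involution; its fixed points are the unpaired elements.\<close>

definition pairing :: "('a \<Rightarrow> 'a \<Rightarrow> bool) \<Rightarrow> 'a set \<Rightarrow> ('a \<Rightarrow> 'a) \<Rightarrow> bool" where
  "pairing R X f \<longleftrightarrow> (\<forall>x\<in>X. f x \<in> X \<and> f (f x) = x \<and> (f x \<noteq> x \<longrightarrow> R x (f x)))"

definition unpaired :: "'a set \<Rightarrow> ('a \<Rightarrow> 'a) \<Rightarrow> 'a set" where
  "unpaired X f = {x \<in> X. f x = x}"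

lemma pairingD:
  assumes "pairing R X f" "x \<in> X"
  shows "f x \<in> X" "f (f x) = x" "f x \<noteq> x \<Longrightarrow> R x (f x)"
  using assms by (auto simp: pairing_def)

lemma pairing_id: "pairing R X id"
  by (simp add: pairing_def)

lemma finite_unpaired: "finite X \<Longrightarrow> finite (unpaired X f)"
  by (simp add: unpaired_def)

lemma pairing_join:
  assumes f: "pairing R X f" and xy: "x \<in> unpaired X f" "y \<in> unpaired X f" "x \<noteq> y"
    and R: "R x y" "R y x"
  shows "pairing R X (f(x := y, y := x))"
    and "unpaired X (f(x := y, y := x)) = unpaired X f - {x, y}"
proof -
  have "f z \<noteq> x \<and> f z \<noteq> y" if "z \<in> X" "z \<noteq> x" "z \<noteq> y" for z
    using pairingD(2)[OF f that(1)] that xy by (auto simp: unpaired_def)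
  then show "pairing R X (f(x := y, y := x))"
    using pairingD[OF f] xy R by (auto simp: pairing_def unpaired_def)
  show "unpaired X (f(x := y, y := x)) = unpaired X f - {x, y}"
    using xy by (auto simp: unpaired_def)
qed

text \<open>Dissolves the pair of \<open>x\<close>. Both right-hand sides refer to the old
  \<open>f\<close>, so the update makes \<open>x\<close> and its former partner fixed
  points.\<close>

lemma pairing_split:
  assumes f: "pairing R X f" and x: "x \<in> X"
  shows "pairing R X (f(x := x, f x := f x))"
    and "unpaired X (f(x := x, f x := f x)) = {x, f x} \<union> unpaired X f"
proof -
  have "f z \<noteq> x \<and> f z \<noteq> f x" if "z \<in> X" "z \<noteq> x" "z \<noteq> f x" for z
    using pairingD(2)[OF f that(1)] pairingD(2)[OF f x] that by metis
  then show "pairing R X (f(x := x, f x := f x))"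
    using pairingD[OF f] x by (auto simp: pairing_def)
  show "unpaired X (f(x := x, f x := f x)) = {x, f x} \<union> unpaired X f"
    using pairingD[OF f x] x by (auto simp: unpaired_def)
qed

text \<open>The exchange along an alternating path of two edges: \<open>v\<close> takes
  \<open>x\<close> over from \<open>f x\<close>, which is left over instead. The number of unpaired
  elements does not change.\<close>

lemma pairing_swap:
  assumes f: "pairing R X f" and v: "v \<in> unpaired X f" and x: "x \<in> X" "f x \<noteq> x"
    and R: "R v x" "R x v"
  defines "g \<equiv> f(x := x, f x := f x, v := x, x := v)"
  shows "pairing R X g"
    and "unpaired X g = insert (f x) (unpaired X f - {v})"
proof -
  have nx: "x \<notin> unpaired X f" "f x \<notin> unpaired X f"
    using pairingD[OF f x(1)] x by (auto simp: unpaired_def)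
  with v have vx: "v \<noteq> x" "v \<noteq> f x" by auto
  note h = pairing_split[OF f x(1)]
  have m: "v \<in> unpaired X (f(x := x, f x := f x))" "x \<in> unpaired X (f(x := x, f x := f x))"
    using h(2) v by auto
  show "pairing R X g" unfolding g_def by (rule pairing_join(1)[OF h(1) m vx(1) R])
  show "unpaired X g = insert (f x) (unpaired X f - {v})"
    unfolding g_def pairing_join(2)[OF h(1) m vx(1) R] h(2) using nx vx x by auto
qed

text \<open>Augmentation along the path \<open>w\<close>, \<open>x\<close>, \<open>f x\<close>,
  \<open>w'\<close>: a swap lets \<open>w\<close> take over \<open>x\<close>, and the freed
  \<open>f x\<close> is then joined with \<open>w'\<close>.\<close>

lemma pairing_augment:
  assumes f: "pairing R X f" and w: "w \<in> unpaired X f" "w' \<in> unpaired X f" "w \<noteq> w'"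
    and x: "x \<in> X" "f x \<noteq> x" and sym: "\<And>u v. R u v \<Longrightarrow> R v u"
    and R: "R w x" "R w' (f x)"
  obtains g where "pairing R X g" "unpaired X g = unpaired X f - {w, w'}"
proof -
  define h where "h = f(x := x, f x := f x, w := x, x := w)"
  have h: "pairing R X h" "unpaired X h = insert (f x) (unpaired X f - {w})"
    using pairing_swap[OF f w(1) x R(1) sym[OF R(1)]] by (simp_all add: h_def)
  have nx: "f x \<notin> unpaired X f"
    using pairingD[OF f x(1)] x by (auto simp: unpaired_def)
  have m: "w' \<in> unpaired X h" "f x \<in> unpaired X h" "w' \<noteq> f x"
    using h(2) w nx by auto
  note k = pairing_join[OF h(1) m R(2) sym[OF R(2)]]
  show thesis
    by (rule that[OF k(1)]) (use k(2) h(2) nx in auto)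
qed

text \<open>A pairing with the fewest unpaired elements will do, since joining two related unpaired
  elements would lower their number.\<close>

lemma ex_maximal_pairing:
  assumes "finite X" and sym: "\<And>u v. R u v \<Longrightarrow> R v u"
  obtains f where "pairing R X f"
    "\<And>x y. x \<in> unpaired X f \<Longrightarrow> y \<in> unpaired X f \<Longrightarrow> x \<noteq> y \<Longrightarrow> \<not> R x y"
proof -
  obtain f where f: "pairing R X f"
    and min: "\<And>g. pairing R X g \<Longrightarrow> card (unpaired X f) \<le> card (unpaired X g)"
    using ex_has_least_nat[of "pairing R X" id "\<lambda>f. card (unpaired X f)"] pairing_id by blast
  have "\<not> R x y" if xy: "x \<in> unpaired X f" "y \<in> unpaired X f" "x \<noteq> y" for x y
  proof
    assume R: "R x y"
    have "card (unpaired X f - {x, y}) < card (unpaired X f)"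
      using xy assms(1) by (intro psubset_card_mono finite_unpaired) auto
    with min[OF pairing_join(1)[OF f xy R sym[OF R]]] pairing_join(2)[OF f xy R sym[OF R]]
    show False by simp
  qed
  with f that show thesis by blast
qed

lemma pairing_sum:
  assumes "pairing R X f"
  shows "(\<Sum>x\<in>X. g (f x)) = sum g X"
  by (rule sum.reindex_bij_witness[of _ f f]) (use assms in \<open>auto simp: pairing_def\<close>)

lemma pairing_restrict:
  assumes "pairing R X f"
  shows "pairing R {x \<in> X. f x \<noteq> x} f"
  using assms unfolding pairing_def by auto

lemma pairing_ex_sign:
  fixes f :: "'a \<Rightarrow> 'a"
  assumes "pairing R X f"
  obtains t :: "'a \<Rightarrow> real" where "\<And>x. \<bar>t x\<bar> = 1"
    "\<And>x. x \<in> X \<Longrightarrow> f x \<noteq> x \<Longrightarrow> t (f x) = - t x"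
proof -
  \<comment> \<open>The choice depends only on the set \<open>{x, f x}\<close>, so both members of a
    pair pick the same representative; that one receives the sign 1.\<close>
  define c where "c x = (SOME z. z \<in> {x, f x})" for x
  have c: "c x \<in> {x, f x}" for x
    unfolding c_def by (rule someI[of _ x]) simp
  have cc: "c (f x) = c x" if "x \<in> X" for x
    using assms that by (simp add: c_def pairing_def insert_commute)
  show thesis
  proof (rule that[of "\<lambda>x. if x = c x then 1 else -1"])
    fix x assume x: "x \<in> X" "f x \<noteq> x"
    show "(if f x = c (f x) then 1 else -1) = - (if x = c x then 1 else - 1 :: real)"
      using cc[OF x(1)] c[of x] x(2) by auto
  qed simp
qed


section \<open>Random signs that are opposite on pairs\<close>

text \<open>The sample space of the random splitting; an expectation is a sum over it divided by its
  cardinality. The value 0 away from pairs keeps the space finite and lets unpaired vertices drop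
  out of all sums.\<close>

definition pair_signs :: "'a set \<Rightarrow> ('a \<Rightarrow> 'a) \<Rightarrow> ('a \<Rightarrow> real) set" where
  "pair_signs X f = {s. (\<forall>x. x \<in> X \<and> f x \<noteq> x \<longrightarrow> \<bar>s x\<bar> = 1 \<and> s (f x) = - s x) \<and>
     (\<forall>x. \<not> (x \<in> X \<and> f x \<noteq> x) \<longrightarrow> s x = 0)}"

definition flip :: "('a \<Rightarrow> 'a) \<Rightarrow> 'a \<Rightarrow> ('a \<Rightarrow> real) \<Rightarrow> 'a \<Rightarrow> real" where
  "flip f x s = (\<lambda>z. if z = x \<or> z = f x then - s z else s z)"

lemma finite_pair_signs:
  assumes "finite X"
  shows "finite (pair_signs X f)"
proof (rule finite_subset)
  show "pair_signs X f \<subseteq> {s. \<forall>x. (x \<in> X \<longrightarrow> s x \<in> {0, 1, -1}) \<and> (x \<notin> X \<longrightarrow> s x = 0)}"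
    unfolding pair_signs_def by (auto simp: abs_if split: if_splits)
  show "finite {s :: 'a \<Rightarrow> real. \<forall>x. (x \<in> X \<longrightarrow> s x \<in> {0, 1, -1}) \<and> (x \<notin> X \<longrightarrow> s x = 0)}"
    by (rule finite_set_of_finite_funs) (simp_all add: assms)
qed

lemma pair_signs_nonempty:
  assumes "pairing R X f"
  shows "pair_signs X f \<noteq> {}"
proof -
  obtain t :: "'a \<Rightarrow> real" where "\<And>x. \<bar>t x\<bar> = 1"
    "\<And>x. x \<in> X \<Longrightarrow> f x \<noteq> x \<Longrightarrow> t (f x) = - t x"
    using pairing_ex_sign[OF assms] by blast
  then have "(\<lambda>x. if x \<in> X \<and> f x \<noteq> x then t x else 0) \<in> pair_signs X f"
    using pairingD[OF assms] by (auto simp: pair_signs_def)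
  then show ?thesis by blast
qed

lemma sum_pair_signs_flip:
  assumes f: "pairing R X f" and x: "x \<in> X" "f x \<noteq> x"
  shows "(\<Sum>s\<in>pair_signs X f. g (flip f x s)) = (\<Sum>s\<in>pair_signs X f. g s)"
proof (rule sum.reindex_bij_witness[of _ "flip f x" "flip f x"])
  have iff: "f z = x \<or> f z = f x \<longleftrightarrow> z = x \<or> z = f x" if "z \<in> X" for z
    using pairingD(2)[OF f that] pairingD(2)[OF f x(1)] by metis
  show "flip f x s \<in> pair_signs X f" if "s \<in> pair_signs X f" for s
    unfolding pair_signs_def
  proof (intro CollectI conjI allI impI)
    fix z assume z: "z \<in> X \<and> f z \<noteq> z"
    with that have "\<bar>s z\<bar> = 1" "s (f z) = - s z" by (auto simp: pair_signs_def)
    then show "\<bar>flip f x s z\<bar> = 1" "flip f x s (f z) = - flip f x s z"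
      using iff[of z] z by (simp_all add: flip_def)
  next
    fix z assume "\<not> (z \<in> X \<and> f z \<noteq> z)"
    with that show "flip f x s z = 0" by (simp add: pair_signs_def flip_def)
  qed
  then show "s \<in> pair_signs X f \<Longrightarrow> flip f x s \<in> pair_signs X f" for s .
qed (auto simp: flip_def)

text \<open>Flipping the pair of \<open>x\<close> permutes the sample space, negates
  \<open>s x\<close> and leaves \<open>s y\<close> alone, so the sum equals its own
  negative.\<close>

lemma sum_pair_signs_uncorrelated:
  assumes f: "pairing R X f" and x: "x \<in> X" "f x \<noteq> x" and y: "y \<noteq> x" "y \<noteq> f x"
  shows "(\<Sum>s\<in>pair_signs X f. s x * s y) = 0"
proof -
  have "(\<Sum>s\<in>pair_signs X f. s x * s y) = (\<Sum>s\<in>pair_signs X f. flip f x s x * flip f x s y)"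
    using sum_pair_signs_flip[OF f x, of "\<lambda>s. s x * s y"] by simp
  also have "\<dots> = - (\<Sum>s\<in>pair_signs X f. s x * s y)"
    using y by (simp add: flip_def sum_negf)
  finally show ?thesis by simp
qed

text \<open>Flipping the pair of \<open>x\<close> moves the inner sum by twice
  \<open>\<bar>c x - c (f x)\<bar>\<close>. By the triangle inequality the absolute values before
  and after the flip add up to at least this much, and both have the same mean.\<close>

lemma sum_pair_signs_abs:
  assumes "finite X" and f: "pairing R X f" and x: "x \<in> X" "f x \<noteq> x"
  shows "(\<Sum>s\<in>pair_signs X f. \<bar>\<Sum>z\<in>X. c z * s z\<bar>) \<ge> \<bar>c x - c (f x)\<bar> * card (pair_signs X f)"
proof -
  define D where "D s = (\<Sum>z\<in>X. c z * s z)" for s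
  have fx: "f x \<in> X" using pairingD[OF f x(1)] by simp
  have D_flip: "D (flip f x s) = D s - 2 * (c x - c (f x)) * s x" if "s \<in> pair_signs X f" for s
  proof -
    have "c z * flip f x s z = c z * s z - (if z = x then 2 * c x * s x else 0)
        - (if z = f x then 2 * c (f x) * s (f x) else 0)" for z
      using x(2) by (auto simp: flip_def)
    then have "D (flip f x s) = D s - 2 * c x * s x - 2 * c (f x) * s (f x)"
      using x fx assms(1) by (simp add: D_def sum_subtractf)
    moreover have "s (f x) = - s x" using that x by (simp add: pair_signs_def)
    ultimately show ?thesis by (simp add: algebra_simps)
  qed
  have "2 * \<bar>c x - c (f x)\<bar> \<le> \<bar>D s\<bar> + \<bar>D (flip f x s)\<bar>" if "s \<in> pair_signs X f" for s
  proof -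
    have "\<bar>s x\<bar> = 1" using that x by (simp add: pair_signs_def)
    then have "2 * \<bar>c x - c (f x)\<bar> = \<bar>2 * (c x - c (f x)) * s x\<bar>" by (simp only: abs_mult)
    also have "\<dots> = \<bar>D s - D (flip f x s)\<bar>" using D_flip[OF that] by simp
    finally show ?thesis by linarith
  qed
  then have "(\<Sum>s\<in>pair_signs X f. 2 * \<bar>c x - c (f x)\<bar>) \<le>
      (\<Sum>s\<in>pair_signs X f. \<bar>D s\<bar> + \<bar>D (flip f x s)\<bar>)"
    by (rule sum_mono)
  also have "\<dots> = 2 * (\<Sum>s\<in>pair_signs X f. \<bar>D s\<bar>)"
    using sum_pair_signs_flip[OF f x, of "\<lambda>s. \<bar>D s\<bar>"] by (simp add: sum.distrib)
  finally show ?thesis by (simp add: D_def mult.commute)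
qed

text \<open>Give one half of \<open>L\<close> the sign 1 and the rest -1. Negating all signs keeps
  the balance and reverses the sum against \<open>d\<close>, so one of the two choices
  works.\<close>

lemma ex_balanced_sign:
  fixes d :: "'a \<Rightarrow> real"
  assumes "finite L"
  obtains k :: "'a \<Rightarrow> real" where "\<And>x. \<bar>k x\<bar> = 1" "\<bar>\<Sum>x\<in>L. k x\<bar> \<le> 1" "(\<Sum>x\<in>L. k x * d x) \<le> 0"
proof -
  obtain M where M: "M \<subseteq> L" "card M = card L div 2"
    using obtain_subset_with_card_n[of "card L div 2" L] by auto
  define k :: "'a \<Rightarrow> real" where "k x = (if x \<in> M then 1 else -1)" for x
  have "(\<Sum>x\<in>L. k x) = (\<Sum>x\<in>M. k x) + (\<Sum>x\<in>L - M. k x)"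
    using sum.subset_diff[OF M(1) assms] by (simp add: add.commute)
  also have "\<dots> = real (card M) - real (card (L - M))"
    by (simp add: k_def)
  also have "card (L - M) = card L - card L div 2"
    using M assms by (simp add: card_Diff_subset finite_subset)
  also have "real (card M) - real (card L - card L div 2) = - real (card L mod 2)"
  proof -
    have "card L = 2 * (card L div 2) + card L mod 2" by simp
    then show ?thesis unfolding M(2) by linarith
  qed
  finally have k: "\<bar>\<Sum>x\<in>L. k x\<bar> \<le> 1" by simp
  show thesis
  proof (cases "(\<Sum>x\<in>L. k x * d x) \<le> 0")
    case True
    with k that[of k] show ?thesis by (simp add: k_def)
  next
    case False
    with k that[of "\<lambda>x. - k x"] show ?thesis by (simp add: k_def sum_negf)
  qed
qed

section \<open>Matchings of a connected graph\<close>

definition adj :: "'a set set \<Rightarrow> 'a \<Rightarrow> 'a \<Rightarrow> bool" where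
  "adj E x y \<longleftrightarrow> {x, y} \<in> E"

text \<open>The case in which the difference function of \<open>w\<close> on the matched vertices is
  zero: \<open>w\<close> sees both or neither end of every matching edge.\<close>

definition twinned :: "'a set set \<Rightarrow> 'a set \<Rightarrow> ('a \<Rightarrow> 'a) \<Rightarrow> 'a \<Rightarrow> bool" where
  "twinned E V f w \<longleftrightarrow> (\<forall>x\<in>V. f x \<noteq> x \<longrightarrow> adj E w x = adj E w (f x))"

lemma adj_sym: "adj E x y \<Longrightarrow> adj E y x"
  by (simp add: adj_def insert_commute)

lemma adj_commute: "adj E x y \<longleftrightarrow> adj E y x"
  by (simp add: adj_def insert_commute)

context simple_graph
begin

lemma adj_verts: "adj E x y \<Longrightarrow> x \<in> V" "adj E x y \<Longrightarrow> y \<in> V"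
  using edge_subset by (auto simp: adj_def)

lemma not_adj_self [simp]: "\<not> adj E x x"
  using edge_card by (fastforce simp: adj_def)

lemma degree_eq: "degree E v = card {y \<in> V. adj E v y}"
proof -
  have "bij_betw (\<lambda>y. {v, y}) {y \<in> V. adj E v y} {e \<in> E. v \<in> e}"
    unfolding bij_betw_def
  proof
    show "inj_on (\<lambda>y. {v, y}) {y \<in> V. adj E v y}"
      by (auto simp: inj_on_def doubleton_eq_iff)
    show "(\<lambda>y. {v, y}) ` {y \<in> V. adj E v y} = {e \<in> E. v \<in> e}"
    proof (intro equalityI subsetI)
      fix e assume e: "e \<in> {e \<in> E. v \<in> e}"
      then obtain a b where "e = {a, b}" using edge_card[of e] by (auto simp: card_2_iff)
      with e obtain y where "e = {v, y}" by blast
      with e show "e \<in> (\<lambda>y. {v, y}) ` {y \<in> V. adj E v y}"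
        using edge_subset by (auto simp: adj_def)
    qed (auto simp: adj_def)
  qed
  then show ?thesis
    by (simp add: degree_def bij_betw_same_card)
qed

lemma card_neighbours_le:
  assumes "v \<in> V" "\<And>y. y \<in> S \<Longrightarrow> adj E v y"
  shows "card S \<le> max_degree V E"
proof -
  have "card S \<le> degree E v"
    unfolding degree_eq using assms(2) adj_verts(2)[of v] finite_verts by (intro card_mono) auto
  also have "\<dots> \<le> max_degree V E"
    unfolding max_degree_def using assms finite_verts by (intro Max_ge) auto
  finally show ?thesis .
qed

lemma connected_closed:
  assumes "connected_graph V E" "u \<in> V" "u \<in> S"
    and "\<And>x y. x \<in> S \<Longrightarrow> adj E x y \<Longrightarrow> y \<in> S"
  shows "V \<subseteq> S"
proof
  fix v assume "v \<in> V"
  with assms(1,2) have "(u, v) \<in> {(x, y). {x, y} \<in> E}\<^sup>*"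
    by (simp add: connected_graph_def)
  then show "v \<in> S"
    by (induction rule: rtrancl_induct) (use assms in \<open>auto simp: adj_def\<close>)
qed

lemma connected_ex_neighbour:
  assumes "connected_graph V E" "u \<in> V" "card V \<ge> 2"
  obtains z where "adj E u z"
proof -
  have "\<not> V \<subseteq> {u}"
    using assms(3) card_mono[of "{u}" V] by auto
  with connected_closed[OF assms(1,2), of "{u}"] that show thesis by auto
qed

text \<open>A matching is chosen to be maximum and, among the maximum ones, to have as few twinned
  unmatched vertices as possible. Such a vertex can be moved along any edge by a swap, hence
  everywhere in a connected graph; it would meet any second unmatched vertex.\<close>

lemma ex_good_matching:
  assumes conn: "connected_graph V E"
  obtains f where "pairing (adj E) V f"
    "\<And>w w'. w \<in> unpaired V f \<Longrightarrow> w' \<in> unpaired V f \<Longrightarrow> \<not> adj E w w'"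
    "\<And>w. w \<in> unpaired V f \<Longrightarrow> twinned E V f w \<Longrightarrow> unpaired V f = {w}"
proof -
  define T where "T g = {w \<in> unpaired V g. twinned E V g w}" for g
  \<comment> \<open>A lexicographic order in one number: \<open>T g\<close> has at most
    \<open>card V\<close> elements, so the weight \<open>card V + 1\<close> lets the number of
    unmatched vertices decide first.\<close>
  define F where "F g = card (unpaired V g) * (card V + 1) + card (T g)" for g
  obtain f where f: "pairing (adj E) V f"
    and min: "\<And>g. pairing (adj E) V g \<Longrightarrow> F f \<le> F g"
    using ex_has_least_nat[of "pairing (adj E) V" id F] pairing_id by blast
  have T_le: "card (T g) \<le> card V" for g
    unfolding T_def unpaired_def by (intro card_mono finite_verts) auto
  have min1: "card (unpaired V g) \<ge> card (unpaired V f)" if "pairing (adj E) V g" for g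
  proof (rule ccontr)
    assume "\<not> ?thesis"
    then have "card (unpaired V g) + 1 \<le> card (unpaired V f)" by simp
    then have "(card (unpaired V g) + 1) * (card V + 1) \<le> card (unpaired V f) * (card V + 1)"
      by (rule mult_right_mono) simp
    with min[OF that] T_le[of g] show False by (simp add: F_def)
  qed
  have indep: "\<not> adj E w w'"
    if g: "pairing (adj E) V g" "card (unpaired V g) = card (unpaired V f)"
      and w: "w \<in> unpaired V g" "w' \<in> unpaired V g" for g w w'
  proof
    assume a: "adj E w w'"
    then have ne: "w \<noteq> w'" by auto
    have "card (unpaired V g - {w, w'}) < card (unpaired V g)"
      using w by (intro psubset_card_mono finite_unpaired finite_verts) auto
    with min1[OF pairing_join(1)[OF g(1) w ne a adj_sym[OF a]]]
      pairing_join(2)[OF g(1) w ne a adj_sym[OF a]] g(2)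
    show False by simp
  qed
  \<comment> \<open>Otherwise \<open>w\<close>, \<open>x\<close>, \<open>g x\<close>,
    \<open>w'\<close> is an augmenting path, against the maximality of the matching.\<close>
  have no_aug: "\<not> adj E w' (g x)"
    if g: "pairing (adj E) V g" "card (unpaired V g) = card (unpaired V f)"
      and w: "w \<in> unpaired V g" "w' \<in> unpaired V g" "w \<noteq> w'"
      and x: "x \<in> V" "g x \<noteq> x" "adj E w x" for g w w' x
  proof
    assume a: "adj E w' (g x)"
    have "card (unpaired V g - {w, w'}) < card (unpaired V g)"
      using w by (intro psubset_card_mono finite_unpaired finite_verts) auto
    moreover obtain h where "pairing (adj E) V h" "unpaired V h = unpaired V g - {w, w'}"
      using pairing_augment[OF g(1) w x(1,2) adj_sym x(3) a] by blast
    ultimately show False using min1[of h] g(2) by simp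
  qed
  have "unpaired V f = {v}" if v: "v \<in> unpaired V f" "twinned E V f v" for v
  proof -
    \<comment> \<open>The places to which the unmatched vertex \<open>v\<close> can be moved while
      the other unmatched vertices stay put. The moved vertex stays twinned and the number of
      twinned unmatched vertices is preserved, so that the move can be repeated.\<close>
    define S where "S = {y. \<exists>g. pairing (adj E) V g \<and> y \<notin> unpaired V f - {v} \<and>
      unpaired V g = insert y (unpaired V f - {v}) \<and> twinned E V g y \<and> card (T g) = card (T f)}"
    have step: "z \<in> S" if "y \<in> S" and yz: "adj E y z" for y z
    proof -
      from \<open>y \<in> S\<close> obtain g where g: "pairing (adj E) V g" "y \<notin> unpaired V f - {v}"
        "unpaired V g = insert y (unpaired V f - {v})" "twinned E V g y" "card (T g) = card (T f)"
        by (auto simp: S_def)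
      have cg: "card (unpaired V g) = card (unpaired V f)"
        using g(2,3) card_Suc_Diff1[OF finite_unpaired[OF finite_verts] v(1)]
          finite_unpaired[OF finite_verts, of f]
        by (simp del: card_Diff_insert card_Diff_singleton)
      have y: "y \<in> unpaired V g" using g by simp
      have zV: "z \<in> V" using adj_verts yz by blast
      \<comment> \<open>A neighbour \<open>z\<close> of the unmatched \<open>y\<close> is matched.
        As \<open>y\<close> is twinned, it also sees the partner \<open>x\<close> of
        \<open>z\<close>, so \<open>y\<close> can be matched to \<open>x\<close>, which frees
        \<open>z\<close>.\<close>
      have gz: "g z \<noteq> z" using indep[OF g(1) cg y, of z] zV yz by (auto simp: unpaired_def)
      define x where "x = g z"
      have x: "x \<in> V" "g x = z" "g x \<noteq> x"
        using pairingD[OF g(1) zV] gz by (auto simp: x_def)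
      have yx: "adj E y x" using g(4) zV gz yz by (auto simp: twinned_def x_def)
      define h where "h = g(x := x, g x := g x, y := x, x := y)"
      have h: "pairing (adj E) V h" "unpaired V h = insert z (unpaired V g - {y})"
        using pairing_swap[OF g(1) y x(1,3) yx adj_sym[OF yx]] x(2) by (simp_all add: h_def)
      have zg: "z \<notin> unpaired V g" using gz by (simp add: unpaired_def)
      have uh: "unpaired V h = insert z (unpaired V f - {v})"
        using h(2) g(2,3) by auto
      have hout: "h u = g u" if "u \<noteq> x" "u \<noteq> y" "u \<noteq> z" for u
        using that x(2) by (auto simp: h_def)
      \<comment> \<open>An edge from another unmatched \<open>w\<close> to \<open>x\<close> or
        \<open>z\<close> would complete an augmenting path through this pair to \<open>y\<close>,
        which sees both. Hence replacing the pair cannot make such a \<open>w\<close> newly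
        twinned.\<close>
      have Tsub: "T h \<subseteq> insert z (T g - {y})"
      proof
        fix w assume w: "w \<in> T h"
        show "w \<in> insert z (T g - {y})"
        proof (cases "w = z")
          case False
          with w h(2) have wg: "w \<in> unpaired V g" "w \<noteq> y" and tw: "twinned E V h w"
            by (auto simp: T_def)
          have "twinned E V g w"
            unfolding twinned_def
          proof (intro ballI impI)
            fix u assume u: "u \<in> V" "g u \<noteq> u"
            show "adj E w u = adj E w (g u)"
            proof (cases "u = x \<or> u = z")
              case True
              have "\<not> adj E w x" using no_aug[OF g(1) cg y wg(1) wg(2)[symmetric] zV gz yz]
                by (simp add: x_def)
              moreover have "\<not> adj E w z" using no_aug[OF g(1) cg y wg(1) wg(2)[symmetric] x(1,3) yx] x(2)
                by simp
              ultimately show ?thesis using True x by (auto simp: x_def)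
            next
              case False
              with u y have "h u = g u" by (intro hout) (auto simp: unpaired_def)
              with u tw show ?thesis by (auto simp: twinned_def)
            qed
          qed
          with wg False show ?thesis by (auto simp: T_def)
        qed simp
      qed
      have yT: "y \<in> T g" using y g(4) by (simp add: T_def)
      have fT: "finite (T k)" for k using finite_unpaired[OF finite_verts] by (simp add: T_def)
      have Tge: "card (T h) \<ge> card (T g)"
      proof -
        have "card (unpaired V h) = card (unpaired V f)"
          using h(2) zg cg card_Suc_Diff1[OF finite_unpaired[OF finite_verts] y]
            finite_unpaired[OF finite_verts, of g]
          by (simp del: card_Diff_insert card_Diff_singleton)
        with min[OF h(1)] g(5) show ?thesis by (simp add: F_def)
      qed
      \<comment> \<open>The vertex \<open>y\<close> has left \<open>T g\<close>, and the count must
        not drop by minimality of \<open>F\<close>; only \<open>z\<close> can make up for the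
        loss.\<close>
      have zT: "z \<in> T h"
      proof (rule ccontr)
        assume "z \<notin> T h"
        with Tsub have "T h \<subset> T g" using yT by auto
        from psubset_card_mono[OF fT this] Tge show False by simp
      qed
      have "card (T h) \<le> card (insert z (T g - {y}))"
        by (intro card_mono Tsub) (simp add: fT)
      also have "\<dots> = card (T g)"
        using zg card_Suc_Diff1[OF fT yT] fT[of g]
        by (simp add: T_def del: card_Diff_insert card_Diff_singleton)
      finally have "card (T h) = card (T f)" using Tge g(5) by simp
      moreover have "z \<notin> unpaired V f - {v}" using zg g(3) by auto
      moreover have "twinned E V h z" using zT by (simp add: T_def)
      ultimately show "z \<in> S" unfolding S_def using h(1) uh by blast
    qed
    have "v \<in> S" using v f by (auto simp: S_def intro!: exI[of _ f])
    moreover have "v \<in> V" using v by (simp add: unpaired_def)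
    ultimately have "V \<subseteq> S" using connected_closed[OF conn] step by blast
    \<comment> \<open>No other unmatched vertex of \<open>f\<close> belongs to \<open>S\<close>, yet
      \<open>S\<close> covers \<open>V\<close>.\<close>
    then have "unpaired V f - {v} = {}" by (auto simp: S_def unpaired_def)
    with v show ?thesis by auto
  qed
  with f indep[OF f refl] that show thesis by blast
qed

section \<open>Cut sizes through the quadratic form of the adjacency matrix\<close>

abbreviation a :: "'a \<Rightarrow> 'a \<Rightarrow> real" where
  "a x y \<equiv> of_bool (adj E x y)"

text \<open>The sum runs over ordered pairs, so every edge enters twice.\<close>

definition edge_form :: "('a \<Rightarrow> real) \<Rightarrow> real" where
  "edge_form s = (\<Sum>x\<in>V. \<Sum>y\<in>V. a x y * (s x * s y))"

text \<open>Since the two sides are disjoint, a cut edge arises from exactly one ordered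
  pair.\<close>

lemma edges_between_eq_sum:
  assumes "V1 \<subseteq> V" "V2 \<subseteq> V" "V1 \<inter> V2 = {}"
  shows "real (edges_between E V1 V2) = (\<Sum>x\<in>V1. \<Sum>y\<in>V2. a x y)"
proof -
  have fin: "finite V1" "finite V2" using assms finite_verts by (auto intro: finite_subset)
  define P where "P = (V1 \<times> V2) \<inter> {p. adj E (fst p) (snd p)}"
  have "{e \<in> E. \<exists>x\<in>V1. \<exists>y\<in>V2. e = {x, y}} = (\<lambda>p. {fst p, snd p}) ` P"
  proof (intro equalityI subsetI)
    fix e assume "e \<in> {e \<in> E. \<exists>x\<in>V1. \<exists>y\<in>V2. e = {x, y}}"
    then obtain x y where "e \<in> E" "x \<in> V1" "y \<in> V2" "e = {x, y}" by blast
    then show "e \<in> (\<lambda>p. {fst p, snd p}) ` P"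
      by (intro image_eqI[of _ _ "(x, y)"]) (auto simp: P_def adj_def)
  next
    fix e assume "e \<in> (\<lambda>p. {fst p, snd p}) ` P"
    then obtain x y where "(x, y) \<in> P" "e = {x, y}" by auto
    then show "e \<in> {e \<in> E. \<exists>x\<in>V1. \<exists>y\<in>V2. e = {x, y}}"
      unfolding P_def adj_def by auto
  qed
  moreover have "inj_on (\<lambda>p. {fst p, snd p}) P"
    using assms(3) by (auto simp: inj_on_def P_def doubleton_eq_iff)
  ultimately have "edges_between E V1 V2 = card P"
    by (simp add: edges_between_def card_image)
  also have "real (card P) = (\<Sum>p\<in>V1 \<times> V2. a (fst p) (snd p))"
    using fin by (simp add: P_def)
  finally show ?thesis by (simp add: sum.cartesian_product case_prod_beta)
qed

lemma sum_adj: "(\<Sum>x\<in>V. \<Sum>y\<in>V. a x y) = 2 * real (card E)"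
proof -
  have fin: "finite E"
    using finite_verts edge_subset by (meson Pow_iff finite_Pow_iff finite_subset subsetI)
  have "(\<Sum>x\<in>V. card {e \<in> E. x \<in> e}) = 2 * card E"
  proof (rule sum_multicount[OF finite_verts fin], intro ballI)
    fix e assume "e \<in> E"
    moreover from this have "{x \<in> V. x \<in> e} = e" using edge_subset by blast
    ultimately show "card {x \<in> V. x \<in> e} = 2" using edge_card by simp
  qed
  then have "(\<Sum>x\<in>V. card {y \<in> V. adj E x y}) = 2 * card E"
    by (simp flip: degree_eq add: degree_def)
  then have "(\<Sum>x\<in>V. real (card {y \<in> V. adj E x y})) = 2 * real (card E)"
    unfolding of_nat_sum[symmetric] by simp
  then show ?thesis
    using finite_verts by (simp add: Collect_conj_eq)
qed

text \<open>A cut edge contributes -2 to the form and any other edge 2, so the form is twice the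
  number of edges minus four times the cut.\<close>

lemma edges_between_eq_edge_form:
  assumes s: "\<And>x. x \<in> V \<Longrightarrow> \<bar>s x\<bar> = 1"
  shows "real (edges_between E {x \<in> V. s x = 1} {x \<in> V. s x = -1}) =
    real (card E) / 2 - edge_form s / 4"
proof -
  define P where "P x = (s x = 1)" for x
  define c where "c = real (edges_between E {x \<in> V. s x = 1} {x \<in> V. s x = -1})"
  have neg: "{x \<in> V. s x = -1} = {x \<in> V. \<not> P x}"
    using s by (force simp: P_def)
  have sP: "s x = (if P x then 1 else -1)" if "x \<in> V" for x
    using s[OF that] by (auto simp: P_def)
  have c: "c = (\<Sum>x\<in>V. \<Sum>y\<in>V. a x y * of_bool (P x \<and> \<not> P y))"
  proof -
    have "c = (\<Sum>x\<in>{x \<in> V. P x}. \<Sum>y\<in>{x \<in> V. \<not> P x}. a x y)"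
      unfolding c_def neg unfolding P_def[symmetric] by (rule edges_between_eq_sum) auto
    also have "\<dots> = (\<Sum>x\<in>V. if P x then \<Sum>y\<in>V. if \<not> P y then a x y else 0 else 0)"
      using finite_verts by (simp only: sum.inter_filter)
    also have "\<dots> = (\<Sum>x\<in>V. \<Sum>y\<in>V. a x y * of_bool (P x \<and> \<not> P y))"
      by (intro sum.cong refl) (auto intro!: sum.cong)
    finally show ?thesis .
  qed
  have c': "c = (\<Sum>x\<in>V. \<Sum>y\<in>V. a x y * of_bool (\<not> P x \<and> P y))"
  proof -
    have "a y x * of_bool (P y \<and> \<not> P x) = a x y * of_bool (\<not> P x \<and> P y)" for x y
      using adj_commute[of E x y] by auto
    then show ?thesis unfolding c by (subst sum.swap) simp
  qed
  have "edge_form s = (\<Sum>x\<in>V. \<Sum>y\<in>V. a x y - 2 * (a x y * of_bool (P x \<and> \<not> P y))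
      - 2 * (a x y * of_bool (\<not> P x \<and> P y)))"
    unfolding edge_form_def by (intro sum.cong refl) (auto simp: sP)
  also have "\<dots> = 2 * real (card E) - 2 * c - 2 * c"
    unfolding sum_subtractf sum_distrib_left[symmetric] sum_adj c[symmetric] c'[symmetric] ..
  finally show ?thesis unfolding c_def[symmetric] by linarith
qed

section \<open>From a matching and a pairing of the unmatched vertices to a bisection\<close>

text \<open>With \<open>W\<close> unmatched and \<open>L\<close> left over, the matched vertices
  bring the form to mean \<open>card W - card V\<close>. Orienting the pairs of \<open>g\<close>
  lowers it on average by at least \<open>card W - card L\<close>, so some outcome is at most
  \<open>card L - card V\<close>; the quarter comes from the formula for the cut.\<close>

lemma ex_large_bisection:
  assumes f: "pairing (adj E) V f"
    and indep: "\<And>w w'. w \<in> unpaired V f \<Longrightarrow> w' \<in> unpaired V f \<Longrightarrow> \<not> adj E w w'"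
    and g: "pairing (\<lambda>w w'. \<exists>x\<in>V. f x \<noteq> x \<and> a w x - a w (f x) \<noteq> a w' x - a w' (f x)) (unpaired V f) g"
  shows "\<exists>V1 V2. bisection V V1 V2 \<and> real (edges_between E V1 V2) \<ge>
    real (card E) / 2 + (real (card V) - real (card (unpaired (unpaired V f) g))) / 4"
proof -
  define W where "W = unpaired V f"
  define L where "L = unpaired W g"
  define \<Omega> where "\<Omega> = pair_signs V f"
  \<comment> \<open>The sum of the signs around \<open>w\<close>; only matched neighbours count, as
    \<open>s\<close> vanishes on \<open>W\<close>.\<close>
  define D where "D s w = (\<Sum>z\<in>V. a w z * s z)" for s w
  have WV: "W \<subseteq> V" and LW: "L \<subseteq> W" by (auto simp: W_def L_def unpaired_def)
  have finW: "finite W" using WV finite_verts finite_subset by blast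
  have finL: "finite L" using LW finW finite_subset by blast
  have W_iff: "x \<in> W \<longleftrightarrow> f x = x" if "x \<in> V" for x using that by (simp add: W_def unpaired_def)
  have L_iff: "x \<in> L \<longleftrightarrow> g x = x" if "x \<in> W" for x using that by (simp add: L_def unpaired_def)
  have g': "pairing (\<lambda>w w'. \<exists>x\<in>V. f x \<noteq> x \<and> a w x - a w (f x) \<noteq> a w' x - a w' (f x)) W g"
    using g by (simp add: W_def)
  have fin\<Omega>: "finite \<Omega>" "\<Omega> \<noteq> {}"
    using finite_pair_signs[OF finite_verts] pair_signs_nonempty[OF f] by (auto simp: \<Omega>_def)
  have sW: "s x = 0" if "s \<in> \<Omega>" "x \<in> W" for s x
    using that WV W_iff[of x] by (auto simp: \<Omega>_def pair_signs_def)
  have sA: "\<bar>s x\<bar> = 1" "s (f x) = - s x" if "s \<in> \<Omega>" "x \<in> V" "x \<notin> W" for s x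
    using that W_iff[of x] by (auto simp: \<Omega>_def pair_signs_def)

  have form_mean: "(\<Sum>s\<in>\<Omega>. edge_form s) = - real (card \<Omega>) * (real (card V) - real (card W))"
  proof -
    \<comment> \<open>Only matching edges survive in the mean, each with the constant product
      -1.\<close>
    have corr: "a x y * (\<Sum>s\<in>\<Omega>. s x * s y) = (if y = f x then if x \<in> W then 0 else - real (card \<Omega>) else 0)"
      if x: "x \<in> V" and y: "y \<in> V" for x y
    proof -
      consider "x \<in> W" | "x \<notin> W" "y = x" | "x \<notin> W" "y = f x" "y \<noteq> x" | "x \<notin> W" "y \<noteq> x" "y \<noteq> f x"
        by blast
      then show ?thesis
      proof cases
        case 1
        then have "(\<Sum>s\<in>\<Omega>. s x * s y) = 0"
          by (intro sum.neutral) (simp add: sW)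
        with 1 show ?thesis by simp
      next
        case 2
        then show ?thesis using W_iff[OF x] by simp
      next
        case 3
        have "s x * s y = -1" if "s \<in> \<Omega>" for s
          using sA[OF that x 3(1)] 3(2) by (simp add: abs_if split: if_splits)
        moreover have "adj E x y" using pairingD(3)[OF f x] 3 by simp
        ultimately show ?thesis using 3 by simp
      next
        case 4
        then show ?thesis
          using sum_pair_signs_uncorrelated[OF f x] W_iff[OF x] by (simp add: \<Omega>_def)
      qed
    qed
    have "(\<Sum>s\<in>\<Omega>. edge_form s) = (\<Sum>x\<in>V. \<Sum>y\<in>V. \<Sum>s\<in>\<Omega>. a x y * (s x * s y))"
      unfolding edge_form_def by (subst sum.swap, rule sum.cong[OF refl], subst sum.swap, rule refl)
    also have "\<dots> = (\<Sum>x\<in>V. \<Sum>y\<in>V. if y = f x then if x \<in> W then 0 else - real (card \<Omega>) else 0)"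
      by (intro sum.cong refl) (simp only: sum_distrib_left[symmetric] corr)
    also have "\<dots> = (\<Sum>x\<in>V. if x \<in> W then 0 else - real (card \<Omega>))"
      using finite_verts pairingD(1)[OF f] by (intro sum.cong refl) simp
    also have "\<dots> = (\<Sum>x\<in>V - W. - real (card \<Omega>))"
      using finite_verts by (intro sum.mono_neutral_cong_right) auto
    also have "\<dots> = - real (card \<Omega>) * real (card (V - W))" by simp
    also have "real (card (V - W)) = real (card V) - real (card W)"
      using card_mono[OF finite_verts WV] by (simp add: card_Diff_subset finW WV of_nat_diff)
    finally show ?thesis by (simp add: algebra_simps)
  qed

  have gain_mean: "(\<Sum>s\<in>\<Omega>. \<Sum>w\<in>W. \<bar>D s w - D s (g w)\<bar>) \<ge> real (card \<Omega>) * (real (card W) - real (card L))"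
  proof -
    have "(\<Sum>s\<in>\<Omega>. \<bar>D s w - D s (g w)\<bar>) \<ge> real (card \<Omega>)" if w: "w \<in> W - L" for w
    proof -
      from w L_iff have "w \<in> W" "g w \<noteq> w" by auto
      then obtain x where x: "x \<in> V" "f x \<noteq> x"
        and ne: "a w x - a w (f x) \<noteq> a (g w) x - a (g w) (f x)"
        using pairingD(3)[OF g'] by blast
      have D: "D s w - D s (g w) = (\<Sum>z\<in>V. (a w z - a (g w) z) * s z)" for s
        by (simp add: D_def sum_subtractf left_diff_distrib)
      \<comment> \<open>The two differences are distinct integers, hence at least 1 apart.\<close>
      have "1 \<le> \<bar>(a w x - a (g w) x) - (a w (f x) - a (g w) (f x))\<bar>"
        using ne by (cases "adj E w x"; cases "adj E (g w) x"; cases "adj E w (f x)"; cases "adj E (g w) (f x)") simp_all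
      then have "1 * real (card \<Omega>) \<le> \<bar>(a w x - a (g w) x) - (a w (f x) - a (g w) (f x))\<bar> * real (card \<Omega>)"
        by (rule mult_right_mono) simp
      also have "\<dots> \<le> (\<Sum>s\<in>\<Omega>. \<bar>D s w - D s (g w)\<bar>)"
        unfolding D \<Omega>_def by (rule sum_pair_signs_abs[OF finite_verts f x])
      finally show ?thesis by simp
    qed
    then have "(\<Sum>w\<in>W - L. real (card \<Omega>)) \<le> (\<Sum>w\<in>W - L. \<Sum>s\<in>\<Omega>. \<bar>D s w - D s (g w)\<bar>)"
      by (rule sum_mono)
    also have "\<dots> \<le> (\<Sum>w\<in>W. \<Sum>s\<in>\<Omega>. \<bar>D s w - D s (g w)\<bar>)"
      using finW by (intro sum_mono2) (auto intro: sum_nonneg)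
    also have "\<dots> = (\<Sum>s\<in>\<Omega>. \<Sum>w\<in>W. \<bar>D s w - D s (g w)\<bar>)" by (rule sum.swap)
    finally show ?thesis
      using LW card_mono[OF finW LW] by (simp add: card_Diff_subset finL of_nat_diff mult.commute)
  qed

  obtain s where s: "s \<in> \<Omega>"
    and s_le: "edge_form s - (\<Sum>w\<in>W. \<bar>D s w - D s (g w)\<bar>) \<le> - (real (card V) - real (card L))"
  proof (rule ccontr)
    assume "\<not> thesis"
    with that have "\<And>s. s \<in> \<Omega> \<Longrightarrow> - (real (card V) - real (card L)) <
        edge_form s - (\<Sum>w\<in>W. \<bar>D s w - D s (g w)\<bar>)" by force
    then have "(\<Sum>s\<in>\<Omega>. - (real (card V) - real (card L))) <
        (\<Sum>s\<in>\<Omega>. edge_form s - (\<Sum>w\<in>W. \<bar>D s w - D s (g w)\<bar>))"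
      by (intro sum_strict_mono fin\<Omega>)
    also have "\<dots> = (\<Sum>s\<in>\<Omega>. edge_form s) - (\<Sum>s\<in>\<Omega>. \<Sum>w\<in>W. \<bar>D s w - D s (g w)\<bar>)"
      by (rule sum_subtractf)
    finally show False using form_mean gain_mean by (simp add: algebra_simps)
  qed

  obtain t :: "'a \<Rightarrow> real" where t: "\<And>x. \<bar>t x\<bar> = 1"
    "\<And>x. x \<in> W \<Longrightarrow> g x \<noteq> x \<Longrightarrow> t (g x) = - t x"
    using pairing_ex_sign[OF g'] by blast
  obtain k :: "'a \<Rightarrow> real" where k: "\<And>x. \<bar>k x\<bar> = 1" "\<bar>\<Sum>x\<in>L. k x\<bar> \<le> 1" "(\<Sum>x\<in>L. k x * D s x) \<le> 0"
    using ex_balanced_sign[OF finL] by blast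
  \<comment> \<open>In each pair of \<open>g\<close> the vertex with the larger \<open>D s\<close>
    gets -1 and the other one 1. Ties are broken by \<open>t\<close>, so that \<open>h\<close> is
    opposite on the two members in every case.\<close>
  define h where "h w = (if D s w = D s (g w) then t w else - sgn (D s w - D s (g w)))" for w
  define \<eta> where "\<eta> w = (if w \<in> W then if w \<in> L then k w else h w else 0)" for w
  define r where "r x = s x + \<eta> x" for x
  have gWL: "pairing (\<lambda>w w'. \<exists>x\<in>V. f x \<noteq> x \<and> a w x - a w (f x) \<noteq> a w' x - a w' (f x)) (W - L) g"
  proof -
    have "W - L = {w \<in> W. g w \<noteq> w}" using L_iff by auto
    then show ?thesis using pairing_restrict[OF g'] by simp
  qed
  have h: "\<bar>h w\<bar> = 1" "h w * (D s w - D s (g w)) = - \<bar>D s w - D s (g w)\<bar>" for w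
    using t(1) by (auto simp: h_def abs_sgn_eq sgn_if)
  have h_g: "h (g w) = - h w" if "w \<in> W - L" for w
  proof -
    have gw: "g (g w) = w" using pairingD(2)[OF gWL that] .
    have "t (g w) = - t w" using t(2)[of w] that L_iff by blast
    then show ?thesis unfolding h_def gw by (auto simp: sgn_if)
  qed
  have \<eta>: "\<eta> w = k w" if "w \<in> L" for w using that LW by (auto simp: \<eta>_def)
  have \<eta>': "\<eta> w = h w" if "w \<in> W - L" for w using that by (simp add: \<eta>_def)
  have split: "(\<Sum>w\<in>W. c w) = (\<Sum>w\<in>W - L. c w) + (\<Sum>w\<in>L. c w)" for c :: "'a \<Rightarrow> real"
    by (rule sum.subset_diff[OF LW finW])
  have \<eta>_D: "2 * (\<Sum>w\<in>W. \<eta> w * D s w) \<le> - (\<Sum>w\<in>W. \<bar>D s w - D s (g w)\<bar>)"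
  proof -
    \<comment> \<open>Reindexing one of the two copies by \<open>g\<close> combines the terms of
      each pair.\<close>
    have "2 * (\<Sum>w\<in>W - L. h w * D s w) = (\<Sum>w\<in>W - L. h w * D s w) + (\<Sum>w\<in>W - L. h (g w) * D s (g w))"
      using pairing_sum[OF gWL, of "\<lambda>w. h w * D s w"] by simp
    also have "\<dots> = (\<Sum>w\<in>W - L. h w * (D s w - D s (g w)))"
      unfolding sum.distrib[symmetric]
      by (intro sum.cong refl) (simp add: h_g algebra_simps)
    also have "\<dots> = - (\<Sum>w\<in>W - L. \<bar>D s w - D s (g w)\<bar>)"
      by (simp add: h(2) sum_negf)
    finally have "2 * (\<Sum>w\<in>W - L. h w * D s w) = - (\<Sum>w\<in>W - L. \<bar>D s w - D s (g w)\<bar>)" .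
    moreover have "(\<Sum>w\<in>L. \<bar>D s w - D s (g w)\<bar>) = 0"
      using L_iff LW by (intro sum.neutral) auto
    moreover have "(\<Sum>w\<in>W. \<eta> w * D s w) = (\<Sum>w\<in>W - L. h w * D s w) + (\<Sum>w\<in>L. k w * D s w)"
      unfolding split[of "\<lambda>w. \<eta> w * D s w"] by (simp add: \<eta> \<eta>')
    ultimately show ?thesis using k(3) split[of "\<lambda>w. \<bar>D s w - D s (g w)\<bar>"] by linarith
  qed

  have form_r: "edge_form r = edge_form s + 2 * (\<Sum>w\<in>W. \<eta> w * D s w)"
  proof -
    have \<eta>0: "\<eta> x = 0" if "x \<notin> W" for x using that by (simp add: \<eta>_def)
    \<comment> \<open>As \<open>W\<close> is independent, the form has no terms quadratic in
      \<open>\<eta>\<close>, and its change is linear in \<open>\<eta>\<close>.\<close>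
    have \<eta>\<eta>: "a x y * (\<eta> x * \<eta> y) = 0" for x y
      using indep[of x y] \<eta>0[of x] \<eta>0[of y] by (cases "x \<in> W"; cases "y \<in> W") (auto simp: W_def)
    have "a x y * (r x * r y) = a x y * (s x * s y) + \<eta> x * (a x y * s y) + \<eta> y * (a y x * s x)" for x y
      using \<eta>\<eta>[of x y] adj_commute[of E x y] by (simp add: r_def algebra_simps)
    then have "edge_form r = edge_form s + (\<Sum>x\<in>V. \<Sum>y\<in>V. \<eta> x * (a x y * s y))
        + (\<Sum>x\<in>V. \<Sum>y\<in>V. \<eta> y * (a y x * s x))"
      by (simp add: edge_form_def sum.distrib)
    also have "(\<Sum>x\<in>V. \<Sum>y\<in>V. \<eta> y * (a y x * s x)) = (\<Sum>x\<in>V. \<Sum>y\<in>V. \<eta> x * (a x y * s y))"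
      by (rule sum.swap)
    also have "(\<Sum>x\<in>V. \<Sum>y\<in>V. \<eta> x * (a x y * s y)) = (\<Sum>x\<in>V. \<eta> x * D s x)"
      by (simp only: D_def sum_distrib_left)
    also have "\<dots> = (\<Sum>x\<in>W. \<eta> x * D s x)"
      using WV finite_verts \<eta>0 by (intro sum.mono_neutral_right) auto
    finally show ?thesis by simp
  qed

  have r1: "\<bar>r x\<bar> = 1" if "x \<in> V" for x
    using sW[OF s, of x] sA[OF s that] k(1)[of x] h(1)[of x] by (auto simp: r_def \<eta>_def)
  have balance: "\<bar>\<Sum>x\<in>V. r x\<bar> \<le> 1"
  proof -
    \<comment> \<open>Matching edges and pairs of \<open>g\<close> are balanced in themselves; only
      the signs \<open>k\<close> on \<open>L\<close> can tip the balance, by at most 1.\<close>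
    have "s (f x) = - s x" if "x \<in> V" for x
      using sA(2)[OF s that] sW[OF s, of x] W_iff[OF that] by (cases "x \<in> W") auto
    then have "(\<Sum>x\<in>V. s x) = - (\<Sum>x\<in>V. s x)"
      using pairing_sum[OF f, of s] by (simp add: sum_negf)
    moreover have "(\<Sum>w\<in>W - L. h w) = - (\<Sum>w\<in>W - L. h w)"
      using pairing_sum[OF gWL, of h] h_g by (simp add: sum_negf)
    moreover have "(\<Sum>w\<in>W. \<eta> w) = (\<Sum>w\<in>W - L. h w) + (\<Sum>w\<in>L. k w)"
      unfolding split[of \<eta>] by (simp add: \<eta> \<eta>')
    moreover have "(\<Sum>x\<in>V. \<eta> x) = (\<Sum>w\<in>W. \<eta> w)"
      using WV finite_verts by (intro sum.mono_neutral_right) (auto simp: \<eta>_def)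
    ultimately show ?thesis using k(2) by (simp add: r_def sum.distrib)
  qed

  define V1 where "V1 = {x \<in> V. r x = 1}"
  define V2 where "V2 = {x \<in> V. r x = -1}"
  have "real (card V1) - real (card V2) = (\<Sum>x\<in>V. of_bool (r x = 1) - of_bool (r x = -1))"
    using finite_verts by (simp add: V1_def V2_def sum_subtractf Collect_conj_eq)
  also have "\<dots> = (\<Sum>x\<in>V. r x)"
    using r1 by (intro sum.cong refl) (force simp: abs_if split: if_splits)
  finally have "\<bar>int (card V1) - int (card V2)\<bar> \<le> 1"
    using balance by linarith
  moreover have "V1 \<union> V2 = V" "V1 \<inter> V2 = {}"
    using r1 by (force simp: V1_def V2_def abs_if split: if_splits)+
  ultimately have "bisection V V1 V2" by (simp add: bisection_def)
  moreover have "real (edges_between E V1 V2) = real (card E) / 2 - edge_form r / 4"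
    unfolding V1_def V2_def by (rule edges_between_eq_edge_form[OF r1])
  then have "real (edges_between E V1 V2) \<ge> real (card E) / 2 + (real (card V) - real (card L)) / 4"
    using form_r \<eta>_D s_le by (simp add: field_simps)
  ultimately show ?thesis unfolding L_def W_def by blast
qed

section \<open>Bounding the leftover vertices by the maximum degree\<close>

lemma ex_bisection_max_degree:
  assumes conn: "connected_graph V E" and two: "card V \<ge> 2"
  shows "\<exists>V1 V2. bisection V V1 V2 \<and> real (edges_between E V1 V2) \<ge>
    real (card E) / 2 + (real (card V) + 1 - real (max_degree V E)) / 4"
proof -
  obtain f where f: "pairing (adj E) V f"
    and indep: "\<And>w w'. w \<in> unpaired V f \<Longrightarrow> w' \<in> unpaired V f \<Longrightarrow> \<not> adj E w w'"
    and tw: "\<And>w. w \<in> unpaired V f \<Longrightarrow> twinned E V f w \<Longrightarrow> unpaired V f = {w}"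
    using ex_good_matching[OF conn] by blast
  define R where "R w w' \<longleftrightarrow> (\<exists>x\<in>V. f x \<noteq> x \<and> a w x - a w (f x) \<noteq> a w' x - a w' (f x))" for w w'
  have "R w' w" if "R w w'" for w w' using that unfolding R_def by metis
  then obtain g where g: "pairing R (unpaired V f) g"
    and max: "\<And>x y. x \<in> unpaired (unpaired V f) g \<Longrightarrow> y \<in> unpaired (unpaired V f) g \<Longrightarrow> x \<noteq> y \<Longrightarrow> \<not> R x y"
    using ex_maximal_pairing[OF finite_unpaired[OF finite_verts]] by metis
  define L where "L = unpaired (unpaired V f) g"
  have LW: "L \<subseteq> unpaired V f" by (auto simp: L_def unpaired_def)
  have WV: "unpaired V f \<subseteq> V" by (auto simp: unpaired_def)
  have finL: "finite L" using LW WV finite_verts by (meson finite_subset)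
  have "card L + 1 \<le> max_degree V E"
  proof (cases "L = {}")
    case True
    from two obtain u where u: "u \<in> V" by fastforce
    obtain z where "adj E u z" using connected_ex_neighbour[OF conn u two] .
    then show ?thesis using card_neighbours_le[OF u, of "{z}"] True by simp
  next
    case False
    then obtain w where w: "w \<in> L" by blast
    then have wW: "w \<in> unpaired V f" and wV: "w \<in> V" using LW WV by auto
    show ?thesis
    proof (cases "twinned E V f w")
      case True
      \<comment> \<open>The single leftover vertex sees a neighbour and also that neighbour's
        partner, so the maximum degree is at least 2.\<close>
      have "L = {w}" using tw[OF wW True] LW w by auto
      obtain z where z: "adj E w z" using connected_ex_neighbour[OF conn wV two] .
      then have zV: "z \<in> V" using adj_verts by blast
      have fz: "f z \<noteq> z" using indep[OF wW, of z] z zV by (auto simp: unpaired_def)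
      then have "adj E w (f z)" using True z zV by (auto simp: twinned_def)
      with z have "card {z, f z} \<le> max_degree V E" by (intro card_neighbours_le[OF wV]) auto
      then show ?thesis using fz \<open>L = {w}\<close> by auto
    next
      case False
      \<comment> \<open>Of the two ends of a matching edge, \<open>x\<close> is the one where the
        difference function of \<open>w\<close> is 1. The same value at another \<open>w'\<close> in
        \<open>L\<close> forces \<open>w'\<close> to be adjacent to \<open>x\<close>.\<close>
      obtain x where x: "x \<in> V" "f x \<noteq> x" "adj E w x" "\<not> adj E w (f x)"
      proof -
        obtain y where y: "y \<in> V" "f y \<noteq> y" "adj E w y \<noteq> adj E w (f y)"
          using False by (auto simp: twinned_def)
        show thesis
        proof (cases "adj E w y")
          case True
          then show ?thesis using that[of y] y by simp
        next
          case False
          then show ?thesis using that[of "f y"] y pairingD[OF f y(1)] by auto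
        qed
      qed
      have "adj E x w'" if "w' \<in> L" for w'
      proof -
        have "\<not> R w w'"
          using max[of w w'] w that by (cases "w = w'") (auto simp: L_def R_def)
        then have "a w x - a w (f x) = a w' x - a w' (f x)"
          using x(1,2) unfolding R_def by blast
        with x have "adj E w' x" by (auto simp: of_bool_def split: if_splits)
        then show ?thesis by (rule adj_sym)
      qed
      \<comment> \<open>The partner of \<open>x\<close> is one more neighbour outside
        \<open>L\<close>; it accounts for the extra 1 in the bound.\<close>
      moreover have "adj E x (f x)" using pairingD(3)[OF f x(1,2)] .
      ultimately have "card (insert (f x) L) \<le> max_degree V E"
        by (intro card_neighbours_le[OF x(1)]) auto
      moreover have "f x \<notin> L"
        using pairingD(2)[OF f x(1)] x(2) LW by (auto simp: unpaired_def)
      ultimately show ?thesis using finL by simp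
    qed
  qed
  moreover obtain V1 V2 where "bisection V V1 V2"
    "real (edges_between E V1 V2) \<ge> real (card E) / 2 + (real (card V) - real (card L)) / 4"
    using ex_large_bisection[OF f indep g[unfolded R_def]] unfolding L_def by blast
  ultimately show ?thesis
    by (intro exI[of _ V1] exI[of _ V2] conjI) (auto simp: field_simps)
qed

end

theorem corollary1p4:
  fixes V :: "'a set" and E :: "'a set set" and n m \<Delta> :: nat
  assumes "simple_graph V E"
    and "connected_graph V E"
    and "n = card V" and "n \<ge> 2"
    and "m = card E"
    and "\<Delta> = max_degree V E"
  shows "\<exists>V1 V2. bisection V V1 V2 \<and>
           real (edges_between E V1 V2) \<ge> real m / 2 + (real n + 1 - real \<Delta>) / 4"
  using simple_graph.ex_bisection_max_degree[OF assms(1,2)] assms(3-6) by simp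

end
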